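(* The graph $\Gamma_f=\{(x,f(x)): x\in(0,1]\}$ of the function $f$ is a scale-invariant set, namely $\Gamma_f=\{(1,f(1))\}\cup\bigcup_{i=0}^\infty\Gamma_i$, where $\Gamma_i=\varphi_i(\Gamma_f)$ and $\varphi_i$ is the transformation sending the point $(x,y)$ of the graph, $x=\Delta^E_{g_1(x)g_2(x)\ldots g_n(x)\ldots}$, $y=f(x)$, to the point $(x',y')$ with $x'=\Delta^E_{ig_1(x)g_2(x)\ldots g_n(x)\ldots}$ and $y'=r_i+u_if(x)$.
   Context: Let $\mathbb{Z}_0=\{0,1,2,\dots\}$. Every $x\in(0,1]$ has a unique $E$-representation, i.e. there is a unique sequence $(g_n(x))_{n\ge 1}$ of elements of $\mathbb{Z}_0$ with $x=\sum_{n=1}^\infty \frac{1}{(2+g_1)(2+g_1+g_2)\cdots(2+g_1+\dots+g_n)}$, where $g_n=g_n(x)$; this is written $x=\Delta^E_{g_1g_2\ldots g_n\ldots}$. Conversely, every sequence in $\mathbb{Z}_0$ is the $E$-representation of some $x\in(0,1]$. The number $1$ has all symbols equal to $0$. Standing assumptions: $(u_n)_{n\ge0}$ is a sequence of real numbers such that $\sum_{n=0}^\infty u_n$ converges with sum $1$, $|u_n|<1$ for all $n\ge 0$, and $r_n:=\sum_{i=n+1}^\infty u_i=1-(u_0+\dots+u_n)$ satisfies $0<r_n<1$ for all $n\ge0$. The function $f$ is defined on $(0,1]$ by $f(x)=r_{g_1(x)}+\sum_{k=2}^\infty\bigl(r_{g_k(x)}\prod_{i=1}^{k-1}u_{g_i(x)}\bigr)$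 (the series converges absolutely). *)

theory Defs imports Complex_Main begin

text \<open>Symbol sequences are functions \<open>g :: nat \<Rightarrow> nat\<close> indexed from 0, so \<open>g n\<close> is the
  symbol usually written with index \<open>n + 1\<close>.\<close>

definition E_term :: "(nat \<Rightarrow> nat) \<Rightarrow> nat \<Rightarrow> real" where
  "E_term g n = 1 / (\<Prod>k\<le>n. real (2 + (\<Sum>j\<le>k. g j)))"

definition E_value :: "(nat \<Rightarrow> nat) \<Rightarrow> real" where
  "E_value g = (\<Sum>n. E_term g n)"

text \<open>Meaningful for \<open>0 < x \<le> 1\<close>, where the representing sequence exists and is unique.\<close>

definition E_symbols :: "real \<Rightarrow> nat \<Rightarrow> nat" where
  "E_symbols x = (THE g. E_term g sums x)"

definition tail :: "(nat \<Rightarrow> real) \<Rightarrow> nat \<Rightarrow> real" where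
  "tail u n = (\<Sum>i. u (i + Suc n))"

definition E_fun :: "(nat \<Rightarrow> real) \<Rightarrow> real \<Rightarrow> real" where
  "E_fun u x = tail u (E_symbols x 0)
     + (\<Sum>k. tail u (E_symbols x (Suc k)) * (\<Prod>i\<le>k. u (E_symbols x i)))"

definition E_graph :: "(nat \<Rightarrow> real) \<Rightarrow> (real \<times> real) set" where
  "E_graph u = {(x, E_fun u x) | x. x \<in> {0<..1}}"

text \<open>\<open>case_nat i g\<close> is the sequence \<open>g\<close> with the symbol \<open>i\<close> prepended.\<close>

definition E_map :: "(nat \<Rightarrow> real) \<Rightarrow> nat \<Rightarrow> real \<times> real \<Rightarrow> real \<times> real" where
  "E_map u i = (\<lambda>(x, y). (E_value (case_nat i (E_symbols x)), tail u i + u i * y))"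

end

theory Submission imports Defs begin

text \<open>
  The \<open>E\<close>-representation is the Engel expansion with the denominators
  \<open>q n = 2 + g 0 + \<dots> + g n\<close> as digits. Its value \<open>x\<close> satisfies
  \<open>q 0 * x = 1 + x'\<close>, where \<open>x'\<close> is the value of the shifted digit sequence, and
  \<open>1 / q 0 < x \<le> 1 / (q 0 - 1)\<close>; so \<open>x\<close> determines \<open>q 0\<close>, and by iteration every digit,
  while the greedy choice of digits produces an expansion of any \<open>x \<in> (0, 1]\<close>.
  Hence points of \<open>(0, 1]\<close> correspond bijectively to symbol sequences. On sequences, the
  series defining \<open>f\<close> converges geometrically, because \<open>u\<close> is a null sequence with
  \<open>\<bar>u n\<bar> < 1\<close>, and prepending the symbol \<open>i\<close> turns its value \<open>y\<close> into \<open>r\<^sub>i + u\<^sub>i * y\<close>.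
  Since every sequence begins with some symbol, the images under the maps already cover the
  whole graph.
\<close>

section \<open>Engel series: convergence, bounds and uniqueness of the digits\<close>

definition engel_term :: "(nat \<Rightarrow> nat) \<Rightarrow> nat \<Rightarrow> real" where
  "engel_term q n = 1 / (\<Prod>k\<le>n. real (q k))"

definition engel_digits :: "(nat \<Rightarrow> nat) \<Rightarrow> bool" where
  "engel_digits q \<longleftrightarrow> mono q \<and> 2 \<le> q 0"

lemma engel_digits_ge: "engel_digits q \<Longrightarrow> q 0 \<le> q n"
  by (auto simp: engel_digits_def mono_def)

lemma engel_digits_Suc:
  assumes "engel_digits q"
  shows "engel_digits (q \<circ> Suc)"
proof -
  have "2 \<le> q (Suc 0)"
    using engel_digits_ge[OF assms, of "Suc 0"] assms by (simp add: engel_digits_def)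
  then show ?thesis
    using assms by (auto simp: engel_digits_def mono_def)
qed

lemma engel_term_0: "engel_term q 0 = 1 / real (q 0)"
  by (simp add: engel_term_def)

lemma engel_term_Suc: "engel_term q (Suc n) = engel_term (q \<circ> Suc) n / real (q 0)"
  unfolding engel_term_def prod.atMost_Suc_shift by simp

lemma engel_term_pos:
  assumes "engel_digits q"
  shows "0 < engel_term q n"
proof -
  have "0 < q k" for k
    using engel_digits_ge[OF assms, of k] assms by (simp add: engel_digits_def)
  then show ?thesis
    by (simp add: engel_term_def prod_pos)
qed

text \<open>No digit is below \<open>q 0\<close>, so a geometric series of ratio
  \<open>1 / q 0\<close> dominates. Both convergence and the upper bound on the value come from
  this.\<close>

lemma engel_term_le:
  assumes "engel_digits q"
  shows "engel_term q n \<le> (1 / real (q 0)) ^ Suc n"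
proof -
  have "(\<Prod>k\<le>n. real (q 0)) \<le> (\<Prod>k\<le>n. real (q k))"
    using engel_digits_ge[OF assms] by (intro prod_mono) auto
  moreover have "0 < q 0"
    using assms by (simp add: engel_digits_def)
  ultimately show ?thesis
    unfolding engel_term_def power_one_over
    by (intro divide_left_mono) (auto intro!: mult_pos_pos prod_pos
      dest: order.strict_trans2[OF _ engel_digits_ge[OF assms]])
qed

lemma engel_geometric_sums:
  assumes "engel_digits q"
  shows "(\<lambda>n. (1 / real (q 0)) ^ Suc n) sums (1 / (real (q 0) - 1))"
proof -
  have q: "2 \<le> q 0"
    using assms by (simp add: engel_digits_def)
  then have "(\<lambda>n. (1 / real (q 0)) * (1 / real (q 0)) ^ n)
      sums ((1 / real (q 0)) * (1 / (1 - 1 / real (q 0))))"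
    by (intro sums_mult geometric_sums) auto
  moreover have "(1 / real (q 0)) * (1 / (1 - 1 / real (q 0))) = 1 / (real (q 0) - 1)"
    using q by (simp add: field_simps)
  ultimately show ?thesis
    by simp
qed

lemma summable_engel_term:
  assumes "engel_digits q"
  shows "summable (engel_term q)"
proof (rule summable_comparison_test'[OF sums_summable[OF engel_geometric_sums[OF assms]]])
  show "norm (engel_term q n) \<le> (1 / real (q 0)) ^ Suc n" if "0 \<le> n" for n
    using engel_term_le[OF assms, of n] engel_term_pos[OF assms, of n] by simp
qed

lemma suminf_engel_term_pos: "engel_digits q \<Longrightarrow> 0 < suminf (engel_term q)"
  by (simp add: suminf_pos summable_engel_term engel_term_pos)

lemma suminf_engel_term_le:
  assumes "engel_digits q"
  shows "suminf (engel_term q) \<le> 1 / (real (q 0) - 1)"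
  using suminf_le[OF engel_term_le[OF assms] summable_engel_term[OF assms]
      sums_summable[OF engel_geometric_sums[OF assms]]]
    sums_unique[OF engel_geometric_sums[OF assms]] by simp

lemma suminf_engel_term_rec:
  assumes "engel_digits q"
  shows "real (q 0) * suminf (engel_term q) = 1 + suminf (engel_term (q \<circ> Suc))"
proof -
  have "suminf (engel_term q) = engel_term q 0 + (\<Sum>n. engel_term q (Suc n))"
    using suminf_split_head[OF summable_engel_term[OF assms]] by simp
  also have "(\<Sum>n. engel_term q (Suc n)) = suminf (engel_term (q \<circ> Suc)) / real (q 0)"
    unfolding engel_term_Suc
    by (rule suminf_divide[OF summable_engel_term[OF engel_digits_Suc[OF assms]]])
  finally show ?thesis
    using assms by (simp add: engel_term_0 engel_digits_def field_simps)
qed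

lemma engel_first_digit:
  assumes "engel_digits q"
  shows "int (q 0) = \<lfloor>1 / suminf (engel_term q)\<rfloor> + 1"
proof -
  let ?x = "suminf (engel_term q)"
  have q: "2 \<le> q 0"
    using assms by (simp add: engel_digits_def)
  have x: "0 < ?x"
    by (rule suminf_engel_term_pos[OF assms])
  \<comment> \<open>Strict, since the shifted expansion has positive value; the other bound is not
    strict. This asymmetry fixes the floor even when \<open>1 / ?x\<close> is an integer.\<close>
  have "1 < real (q 0) * ?x"
    using suminf_engel_term_rec[OF assms] suminf_engel_term_pos[OF engel_digits_Suc[OF assms]]
    by simp
  then have "1 / ?x < real (q 0)"
    using x by (simp add: field_simps)
  moreover have "real (q 0) - 1 \<le> 1 / ?x"
    using suminf_engel_term_le[OF assms] x q by (simp add: field_simps)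
  ultimately have "\<lfloor>1 / ?x\<rfloor> = int (q 0) - 1"
    by (intro floor_unique) auto
  then show ?thesis
    by simp
qed

lemma engel_digits_unique:
  assumes "engel_digits p" "engel_digits q" "suminf (engel_term p) = suminf (engel_term q)"
  shows "p = q"
proof
  fix n
  show "p n = q n"
    using assms
  proof (induction n arbitrary: p q)
    case 0
    then show ?case
      using engel_first_digit[of p] engel_first_digit[of q] by simp
  next
    case (Suc n)
    then have "p 0 = q 0"
      using engel_first_digit[of p] engel_first_digit[of q] by simp
    then have "suminf (engel_term (p \<circ> Suc)) = suminf (engel_term (q \<circ> Suc))"
      using suminf_engel_term_rec[of p] suminf_engel_term_rec[of q] Suc.prems by simp
    then have "(p \<circ> Suc) n = (q \<circ> Suc) n"
      by (rule Suc.IH[OF engel_digits_Suc[OF Suc.prems(1)] engel_digits_Suc[OF Suc.prems(2)]])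
    then show ?case
      by simp
  qed
qed

section \<open>Existence of expansions by the greedy algorithm\<close>

lemma engel_digits_exist:
  fixes x :: real
  assumes "0 < x" "x \<le> 1"
  obtains q where "engel_digits q" "engel_term q sums x"
proof -
  \<comment> \<open>For positive \<open>t\<close> this is the least integer strictly above
    \<open>1 / t\<close>, the choice forced by \<open>engel_first_digit\<close>.\<close>
  define digit where "digit t = nat \<lfloor>1 / t\<rfloor> + 1" for t :: real
  \<comment> \<open>\<open>y n\<close> is meant to be the value of the expansion shifted by
    \<open>n\<close>; the recursion is \<open>suminf_engel_term_rec\<close> solved for the shifted
    value.\<close>
  define y where "y = rec_nat x (\<lambda>_ t. real (digit t) * t - 1)"
  define q where "q = digit \<circ> y"
  have y_0: "y 0 = x" and y_Suc: "y (Suc n) = real (q n) * y n - 1" for n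
    by (simp_all add: y_def q_def)
  \<comment> \<open>The first bound keeps the remainders positive. The second makes them
    nonincreasing, hence at most 1, and so the digits nondecreasing.\<close>
  have step: "1 < real (digit t) * t \<and> real (digit t) * t - 1 \<le> t" if "0 < t" for t :: real
  proof -
    have "1 / t < real (digit t)" "real (digit t) \<le> 1 / t + 1"
      using that by (auto simp: digit_def) linarith+
    then show ?thesis
      using that by (simp add: field_simps)
  qed
  have y: "0 < y n" "y n \<le> 1" for n
  proof (induction n)
    case (Suc n)
    {
      case 1
      show ?case using step[OF Suc(1)] by (simp add: y_Suc q_def)
    next
      case 2
      show ?case using step[OF Suc(1)] Suc(2) by (simp add: y_Suc q_def)
    }
  qed (use assms y_0 in auto)
  have "q n \<le> q (Suc n)" for n
  proof -
    have "y (Suc n) \<le> y n"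
      using step[OF y(1)[of n]] by (simp add: y_Suc q_def)
    then have "1 / y n \<le> 1 / y (Suc n)"
      using y by (simp add: frac_le)
    then show ?thesis
      by (simp add: q_def digit_def floor_mono nat_mono)
  qed
  then have "mono q"
    by (simp add: mono_iff_le_Suc)
  moreover have "2 \<le> q 0"
    using assms by (simp add: q_def digit_def y_0 le_nat_iff le_floor_iff)
  ultimately have q: "engel_digits q"
    by (simp add: engel_digits_def)
  have partial: "x = (\<Sum>k<n. engel_term q k) + y n / (\<Prod>k<n. real (q k))" for n
  proof (induction n)
    case 0
    show ?case by (simp add: y_0)
  next
    case (Suc n)
    have "(\<Prod>k<n. real (q k)) \<noteq> 0" "q n \<noteq> 0"
      by (auto simp: q_def digit_def)
    then have "y n / (\<Prod>k<n. real (q k)) = engel_term q n + y (Suc n) / (\<Prod>k<Suc n. real (q k))"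
      by (simp add: engel_term_def y_Suc field_simps flip: lessThan_Suc_atMost)
    with Suc show ?case by simp
  qed
  \<comment> \<open>By \<open>partial\<close>, the error after \<open>Suc n\<close> terms is
    \<open>y (Suc n) * engel_term q n\<close>, which lies between 0 and the general term of a
    convergent series.\<close>
  have "(\<lambda>n. x - (\<Sum>k<Suc n. engel_term q k)) \<longlonglongrightarrow> 0"
  proof (rule real_tendsto_sandwich[OF _ _ tendsto_const
        summable_LIMSEQ_zero[OF summable_engel_term[OF q]]])
    have *: "x - (\<Sum>k<Suc n. engel_term q k) = y (Suc n) * engel_term q n" for n
      using partial[of "Suc n"] by (simp add: engel_term_def lessThan_Suc_atMost)
    show "\<forall>\<^sub>F n in sequentially. 0 \<le> x - (\<Sum>k<Suc n. engel_term q k)"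
      unfolding * using y(1) engel_term_pos[OF q] by (simp add: less_imp_le)
    show "\<forall>\<^sub>F n in sequentially. x - (\<Sum>k<Suc n. engel_term q k) \<le> engel_term q n"
      unfolding * using y engel_term_pos[OF q]
      by (intro always_eventually allI mult_left_le_one_le) (auto simp: less_imp_le)
  qed
  moreover have "(\<lambda>n. x - (\<Sum>k<Suc n. engel_term q k)) \<longlonglongrightarrow> x - suminf (engel_term q)"
    by (intro tendsto_diff tendsto_const LIMSEQ_Suc summable_LIMSEQ summable_engel_term[OF q])
  ultimately have "x - suminf (engel_term q) = 0"
    by (rule LIMSEQ_unique[rotated])
  then have "engel_term q sums x"
    using summable_sums[OF summable_engel_term[OF q]] by simp
  with q show ?thesis
    by (rule that)
qed

section \<open>From digits back to symbols\<close>

definition E_digits :: "(nat \<Rightarrow> nat) \<Rightarrow> nat \<Rightarrow> nat" where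
  "E_digits g n = 2 + (\<Sum>j\<le>n. g j)"

lemma E_term_eq_engel_term: "E_term g = engel_term (E_digits g)"
  by (simp add: fun_eq_iff E_term_def engel_term_def E_digits_def)

lemma engel_digits_E_digits: "engel_digits (E_digits g)"
  by (simp add: engel_digits_def E_digits_def mono_iff_le_Suc)

text \<open>Symbols are differences of neighbouring digits, the first being the first digit minus 2.
  At \<open>n = 0\<close> the truncated \<open>n - 1\<close> only repeats the same equation.\<close>

lemma inj_E_digits: "inj E_digits"
proof (intro injI ext)
  fix g h n
  assume eq: "E_digits g = E_digits h"
  show "g n = h n"
    using fun_cong[OF eq, of n] fun_cong[OF eq, of "n - 1"]
    by (cases n) (simp_all add: E_digits_def)
qed

lemma E_digits_surj:
  assumes "engel_digits q"
  obtains g where "E_digits g = q"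
proof
  \<comment> \<open>Truncated subtraction is exact here because \<open>2 \<le> q 0\<close> and
    \<open>q\<close> is monotone.\<close>
  show "E_digits (case_nat (q 0 - 2) (\<lambda>n. q (Suc n) - q n)) = q" (is "E_digits ?g = q")
  proof
    fix n
    show "E_digits ?g n = q n"
    proof (induction n)
      case 0
      then show ?case
        using assms by (auto simp: E_digits_def engel_digits_def)
    next
      case (Suc n)
      have "q n \<le> q (Suc n)"
        using assms by (simp add: engel_digits_def mono_iff_le_Suc)
      with Suc show ?case
        by (simp add: E_digits_def)
    qed
  qed
qed

lemma E_term_sums: "E_term g sums E_value g"
  unfolding E_value_def
  by (simp add: E_term_eq_engel_term summable_engel_term engel_digits_E_digits summable_sums)

lemma E_value_in_unit: "E_value g \<in> {0<..1}"
proof -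
  have "1 / (real (E_digits g 0) - 1) \<le> 1"
    by (simp add: E_digits_def)
  then show ?thesis
    using suminf_engel_term_pos[OF engel_digits_E_digits[of g]]
      suminf_engel_term_le[OF engel_digits_E_digits[of g]]
    by (simp add: E_value_def E_term_eq_engel_term)
qed

lemma E_value_inj:
  assumes "E_value g = E_value h"
  shows "g = h"
  using engel_digits_unique[OF engel_digits_E_digits engel_digits_E_digits] assms
    injD[OF inj_E_digits]
  by (simp add: E_value_def E_term_eq_engel_term)

lemma E_symbols_E_value: "E_symbols (E_value g) = g"
  unfolding E_symbols_def
proof (rule the_equality)
  show "E_term g sums E_value g"
    by (rule E_term_sums)
  show "h = g" if "E_term h sums E_value g" for h
    using sums_unique2[OF that E_term_sums] by (auto intro: E_value_inj)
qed

lemma E_value_E_symbols: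
  assumes "x \<in> {0<..1}"
  shows "E_value (E_symbols x) = x"
proof -
  obtain q where q: "engel_digits q" "engel_term q sums x"
    using engel_digits_exist[of x] assms by auto
  obtain g where "E_digits g = q"
    by (rule E_digits_surj[OF q(1)])
  then have "x = E_value g"
    using q(2) E_term_sums[of g] by (simp add: E_term_eq_engel_term sums_unique2)
  then show ?thesis
    by (simp add: E_symbols_E_value)
qed

section \<open>Convergence of the series for \<open>E_fun\<close> and its functional
  equation\<close>

lemma null_sequence_uniform_bound:
  fixes u :: "nat \<Rightarrow> real"
  assumes "u \<longlonglongrightarrow> 0" "\<And>n. \<bar>u n\<bar> < 1"
  obtains c where "0 \<le> c" "c < 1" "\<And>n. \<bar>u n\<bar> \<le> c"
proof -
  obtain N where N: "\<And>n. n \<ge> N \<Longrightarrow> \<bar>u n\<bar> < 1 / 2"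
    using LIMSEQ_D[OF assms(1), of "1 / 2"] by auto
  \<comment> \<open>From \<open>N\<close> on the values stay below 1/2, so a finite maximum bounds
    them all, and it is below 1 because each of its entries is.\<close>
  define c where "c = Max (insert (1 / 2) ((\<lambda>n. \<bar>u n\<bar>) ` {..<N}))"
  have "\<bar>u n\<bar> \<le> c" for n
  proof (cases "n < N")
    case True
    then show ?thesis
      unfolding c_def by (intro Max_ge) auto
  next
    case False
    then have "\<bar>u n\<bar> \<le> 1 / 2"
      using N[of n] by simp
    also have "1 / 2 \<le> c"
      unfolding c_def by (intro Max_ge) auto
    finally show ?thesis .
  qed
  moreover have "c < 1"
    unfolding c_def using assms(2) by (subst Max_less_iff) auto
  moreover have "0 \<le> c"
    using calculation(1)[of 0] by linarith
  ultimately show ?thesis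
    by (intro that)
qed

text \<open>Applied with \<open>u\<close> and \<open>tail u\<close> composed with a symbol sequence,
  which is why the bounds are uniform in \<open>n\<close>.\<close>

lemma summable_mult_prod:
  fixes u t :: "nat \<Rightarrow> real"
  assumes "0 \<le> c" "c < 1" "\<And>n. \<bar>u n\<bar> \<le> c" "\<And>n. \<bar>t n\<bar> \<le> 1"
  shows "summable (\<lambda>k. t k * (\<Prod>i<k. u i))"
proof (rule summable_comparison_test'[OF summable_geometric[of c]])
  show "norm c < 1"
    using assms by simp
  fix k :: nat
  have "(\<Prod>i<k. \<bar>u i\<bar>) \<le> (\<Prod>i<k. c)"
    using assms(3) by (intro prod_mono) auto
  then have "\<bar>t k\<bar> * (\<Prod>i<k. \<bar>u i\<bar>) \<le> 1 * c ^ k"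
    using assms(4) by (intro mult_mono) (auto simp: prod_nonneg)
  then show "norm (t k * (\<Prod>i<k. u i)) \<le> c ^ k"
    by (simp add: abs_mult abs_prod)
qed

lemma E_fun_E_value_case_nat:
  fixes u :: "nat \<Rightarrow> real"
  assumes "u \<longlonglongrightarrow> 0" "\<And>n. \<bar>u n\<bar> < 1" "\<And>n. \<bar>tail u n\<bar> \<le> 1"
  shows "E_fun u (E_value (case_nat i g)) = tail u i + u i * E_fun u (E_value g)"
proof -
  \<comment> \<open>One series for all of \<open>E_fun\<close>: the empty product at
    \<open>k = 0\<close> yields its separate first summand. Prepending \<open>i\<close> then shifts
    the series by one place and multiplies each term by \<open>u i\<close>.\<close>
  let ?a = "\<lambda>k. tail u (g k) * (\<Prod>j<k. u (g j))"
  obtain c where "0 \<le> c" "c < 1" "\<And>n. \<bar>u n\<bar> \<le> c"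
    by (rule null_sequence_uniform_bound[OF assms(1,2)]) auto
  then have a: "summable ?a"
    using assms(3) by (intro summable_mult_prod[of c]) auto
  have "(\<Sum>k. ?a k) = E_fun u (E_value g)"
    using suminf_split_head[OF a]
    by (simp add: E_fun_def E_symbols_E_value lessThan_Suc_atMost)
  moreover have "(\<Prod>j\<le>k. u (case_nat i g j)) = u i * (\<Prod>j<k. u (g j))" for k
    unfolding lessThan_Suc_atMost[symmetric] prod.lessThan_Suc_shift by simp
  then have "E_fun u (E_value (case_nat i g)) = tail u i + (\<Sum>k. u i * ?a k)"
    by (simp add: E_fun_def E_symbols_E_value mult_ac)
  ultimately show ?thesis
    by (simp add: suminf_mult[OF a])
qed

section \<open>The graph parametrised by symbol sequences\<close>

lemma E_graph_eq_range: "E_graph u = range (\<lambda>g. (E_value g, E_fun u (E_value g)))"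
proof -
  have "range E_value = {0<..1}"
    using E_value_in_unit E_value_E_symbols by (metis image_subset_iff rangeI subsetI subset_antisym)
  then have "E_graph u = (\<lambda>x. (x, E_fun u x)) ` range E_value"
    by (auto simp: E_graph_def)
  then show ?thesis
    by (simp add: image_image)
qed

theorem theorem8:
  fixes u :: "nat \<Rightarrow> real"
  assumes "u sums 1"
    and "\<And>n. \<bar>u n\<bar> < 1"
    and "\<And>n. 0 < tail u n \<and> tail u n < 1"
  shows "E_graph u = {(1, E_fun u 1)} \<union> (\<Union>i. E_map u i ` E_graph u)"
proof -
  define point where "point g = (E_value g, E_fun u (E_value g))" for g
  have graph: "E_graph u = range point"
    by (simp add: E_graph_eq_range point_def)
  have "u \<longlonglongrightarrow> 0"
    using assms(1) by (intro summable_LIMSEQ_zero sums_summable)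
  moreover have "\<bar>tail u n\<bar> \<le> 1" for n
    using assms(3)[of n] by simp
  \<comment> \<open>In this parametrisation \<open>E_map u i\<close> is simply the prepending of
    \<open>i\<close>.\<close>
  ultimately have map: "E_map u i (point g) = point (case_nat i g)" for i g
    using assms(2) by (simp add: E_map_def point_def E_symbols_E_value E_fun_E_value_case_nat)
  \<comment> \<open>Splitting off the first symbol exhibits each point of the graph as an image
    under one of the maps.\<close>
  have "point g = E_map u (g 0) (point (g \<circ> Suc))" for g
  proof -
    have "case_nat (g 0) (g \<circ> Suc) = g"
      by (auto split: nat.split)
    then show ?thesis
      by (simp add: map)
  qed
  then have "E_graph u \<subseteq> (\<Union>i. E_map u i ` E_graph u)"
    unfolding graph by blast
  moreover have "(\<Union>i. E_map u i ` E_graph u) \<subseteq> E_graph u"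
    unfolding graph by (auto simp: map)
  moreover have "(1, E_fun u 1) \<in> E_graph u"
    by (auto simp: E_graph_def)
  ultimately show ?thesis
    by blast
qed

end
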